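(* Let $a,b$ be positive integers such that $\Gamma=\mathrm{SL}(1,\mathbb{H}_{\mathbb{Z}}^{a,b})$ is a cocompact lattice of $G=\mathrm{SL}(1,\mathbb{H}_{\mathbb{R}}^{a,b})$. If $g=x+yi\in\mathrm{SL}(1,\mathbb{H}_{\mathbb{Q}}^{a,b})$, then $g\Gamma\in G/\Gamma$ is not finitely blockable from $m_0=\Gamma$. Therefore the homogeneous space $G/\Gamma$ is not finitely blockable.
   Context: For a commutative ring $R\in\{\mathbb{Z},\mathbb{Q},\mathbb{R}\}$ and positive integers $a,b$, $\mathbb{H}_R^{a,b}=\{x+yi+zj+wk : x,y,z,w\in R\}$ is the quaternion ring with componentwise addition and multiplication determined by $i^2=a$, $j^2=b$, $ij=k=-ji$, with elements of $R$ central. The reduced norm is $N_{\mathrm{red}}(x+yi+zj+wk)=x^2-ay^2-bz^2+abw^2$, and $\mathrm{SL}(1,\mathbb{H}_R^{a,b})=\{g\in\mathbb{H}_R^{a,b} : N_{\mathrm{red}}(g)=1\}$. The Lie group $\mathrm{SL}(1,\mathbb{H}_{\mathbb{R}}^{a,b})$ is isomorphic to $\mathrm{SL}(2,\mathbb{R})$. Blocking: let $G$ be a connected Lie group with Lie algebra $\mathfrak{g}$ and exponential map $\exp$, let $\Gamma\subset G$ be a lattice, and let $M=G/\Gamma$ with $G$ acting by left multiplication. For (not necessarily distinct) $m_1,m_2\in M$, the connecting curves for the pair $m_1,m_2$ are the parametrized curves $c(t)=\exp(tX)\cdot m$, $0\le t\le 1$, with $X\in\mathfrak{g}$, $m\in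 M$, such that $c(0)=m_1$ and $c(1)=m_2$. A finite set $B\subset M\setminus\{m_1,m_2\}$ is a blocking set for the pair if $c([0,1])\cap B\neq\emptyset$ for every connecting curve $c$ of the pair. The points $m_1,m_2$ are (finitely) blockable from each other if a blocking set exists. The space $M$ is (finitely) blockable if every pair of its points is blockable. *)

theory Defs
  imports "HOL-Analysis.Analysis" "HOL-Algebra.Ring" "HOL-Algebra.Left_Coset"
begin

section \<open>Quaternion rings\<close>

text \<open>
  The tuple \<open>(x, y, z, w)\<close> stands for \<open>x + yi + zj + wk\<close>.  Addition, scalar multiplication,
  norm and topology are those of the product type.  The quaternion rings over the integers and the
  rationals are realised inside the real one, by restricting the coordinates to \<open>\<int>\<close> or \<open>\<rat>\<close>.
\<close>

type_synonym quat = "real \<times> real \<times> real \<times> real"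

text \<open>
  The bilinear associative product with \<open>i\<^sup>2 = a\<close>, \<open>j\<^sup>2 = b\<close>, \<open>ij = k = -ji\<close>; it follows that
  \<open>k\<^sup>2 = -ab\<close>, \<open>ik = aj = -ki\<close> and \<open>jk = -bi = -kj\<close>.
\<close>

fun qmult :: "nat \<Rightarrow> nat \<Rightarrow> quat \<Rightarrow> quat \<Rightarrow> quat" where
  "qmult a b (x, y, z, w) (x', y', z', w') =
     (x * x' + a * y * y' + b * z * z' - a * b * w * w',
      x * y' + y * x' - b * z * w' + b * w * z',
      x * z' + z * x' + a * y * w' - a * w * y',
      x * w' + w * x' + y * z' - z * y')"

definition quat_ring :: "real set \<Rightarrow> nat \<Rightarrow> nat \<Rightarrow> quat ring" where
  "quat_ring R a b =
     \<lparr>carrier = R \<times> R \<times> R \<times> R, monoid.mult = qmult a b, one = (1, 0, 0, 0),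
      zero = 0, add = (+)\<rparr>"

fun nred :: "nat \<Rightarrow> nat \<Rightarrow> quat \<Rightarrow> real" where
  "nred a b (x, y, z, w) = x\<^sup>2 - a * y\<^sup>2 - b * z\<^sup>2 + a * b * w\<^sup>2"

definition SL1 :: "real set \<Rightarrow> nat \<Rightarrow> nat \<Rightarrow> quat monoid" where
  "SL1 R a b =
     \<lparr>carrier = {g \<in> carrier (quat_ring R a b). nred a b g = 1},
      monoid.mult = qmult a b, one = (1, 0, 0, 0)\<rparr>"

lemma qmult_generators:
  "qmult a b (0, 1, 0, 0) (0, 1, 0, 0) = (real a, 0, 0, 0)"
  "qmult a b (0, 0, 1, 0) (0, 0, 1, 0) = (real b, 0, 0, 0)"
  "qmult a b (0, 1, 0, 0) (0, 0, 1, 0) = (0, 0, 0, 1)"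
  "qmult a b (0, 0, 1, 0) (0, 1, 0, 0) = - (0, 0, 0, 1)"
  by simp_all

lemma qmult_assoc: "qmult a b (qmult a b g h) k = qmult a b g (qmult a b h k)"
  by (cases g; cases h; cases k) (simp add: algebra_simps)

lemma nred_qmult: "nred a b (qmult a b g h) = nred a b g * nred a b h"
  by (cases g; cases h) (simp add: algebra_simps power2_eq_square)

lemma ring_quat_ring:
  assumes "R \<in> {\<int>, \<rat>, UNIV}"
  shows "ring (quat_ring R a b)"
proof (rule ringI)
  have R: "0 \<in> R" "1 \<in> R" "\<And>x y. x \<in> R \<Longrightarrow> y \<in> R \<Longrightarrow> x + y \<in> R"
    "\<And>x y. x \<in> R \<Longrightarrow> y \<in> R \<Longrightarrow> x * y \<in> R" "\<And>x y. x \<in> R \<Longrightarrow> y \<in> R \<Longrightarrow> x - y \<in> R"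
    "\<And>x. x \<in> R \<Longrightarrow> - x \<in> R" "\<And>n. real n \<in> R"
    using assms by auto
  show "abelian_group (quat_ring R a b)"
  proof (rule abelian_groupI)
    fix g assume "g \<in> carrier (quat_ring R a b)"
    then have "- g \<in> carrier (quat_ring R a b)"
      by (auto simp: quat_ring_def R)
    moreover have "- g \<oplus>\<^bsub>quat_ring R a b\<^esub> g = \<zero>\<^bsub>quat_ring R a b\<^esub>"
      by (simp add: quat_ring_def)
    ultimately show "\<exists>h\<in>carrier (quat_ring R a b). h \<oplus>\<^bsub>quat_ring R a b\<^esub> g = \<zero>\<^bsub>quat_ring R a b\<^esub>"
      by (rule bexI[rotated])
  qed (auto simp: quat_ring_def zero_prod_def R add.assoc)
  show "monoid (quat_ring R a b)"
    by (rule monoidI) (auto simp: quat_ring_def R qmult_assoc)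
qed (auto simp: quat_ring_def algebra_simps)

lemma group_SL1:
  assumes "R \<in> {\<int>, \<rat>, UNIV}"
  shows "group (SL1 R a b)"
proof (rule groupI)
  interpret ring "quat_ring R a b"
    by (rule ring_quat_ring[OF assms])
  show "g \<otimes>\<^bsub>SL1 R a b\<^esub> h \<in> carrier (SL1 R a b)"
    if "g \<in> carrier (SL1 R a b)" "h \<in> carrier (SL1 R a b)" for g h
  proof -
    have "qmult a b g h \<in> carrier (quat_ring R a b)"
      using that m_closed[of g h] by (simp add: SL1_def quat_ring_def)
    then show ?thesis
      using that by (simp add: SL1_def nred_qmult)
  qed
  show "\<exists>h\<in>carrier (SL1 R a b). h \<otimes>\<^bsub>SL1 R a b\<^esub> g = \<one>\<^bsub>SL1 R a b\<^esub>"
    if "g \<in> carrier (SL1 R a b)" for g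
  proof -
    obtain x y z w where g: "g = (x, y, z, w)" by (cases g)
    have "- u \<in> R" if "u \<in> R" for u
      using assms that by auto
    then have "(x, - y, - z, - w) \<in> carrier (SL1 R a b)"
      using that by (simp add: SL1_def quat_ring_def g)
    moreover have "(x, - y, - z, - w) \<otimes>\<^bsub>SL1 R a b\<^esub> g = \<one>\<^bsub>SL1 R a b\<^esub>"
      using that by (simp add: SL1_def g algebra_simps power2_eq_square)
    ultimately show ?thesis
      by (rule bexI[rotated])
  qed
  show "\<one>\<^bsub>SL1 R a b\<^esub> \<in> carrier (SL1 R a b)"
    using one_closed by (simp add: SL1_def quat_ring_def)
qed (auto simp: SL1_def qmult_assoc)

lemma subgroup_SL1:
  assumes "R \<in> {\<int>, \<rat>, UNIV}"
  shows "subgroup (carrier (SL1 R a b)) (SL1 UNIV a b)"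
proof -
  interpret S: group "SL1 R a b" by (rule group_SL1[OF assms])
  interpret G: group "SL1 UNIV a b" by (rule group_SL1) simp
  have sub: "carrier (SL1 R a b) \<subseteq> carrier (SL1 UNIV a b)"
    by (auto simp: SL1_def quat_ring_def)
  have eq: "mult (SL1 R a b) = mult (SL1 UNIV a b)" "one (SL1 R a b) = one (SL1 UNIV a b)"
    by (simp_all add: SL1_def)
  show ?thesis
  proof (rule G.subgroupI)
    fix g assume g: "g \<in> carrier (SL1 R a b)"
    have "inv\<^bsub>SL1 UNIV a b\<^esub> g = inv\<^bsub>SL1 R a b\<^esub> g"
      using g sub S.inv_closed[OF g] S.l_inv[OF g] by (intro G.inv_equality) (auto simp: eq)
    then show "inv\<^bsub>SL1 UNIV a b\<^esub> g \<in> carrier (SL1 R a b)"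
      using S.inv_closed[OF g] by simp
  next
    fix g h assume "g \<in> carrier (SL1 R a b)" "h \<in> carrier (SL1 R a b)"
    then show "g \<otimes>\<^bsub>SL1 UNIV a b\<^esub> h \<in> carrier (SL1 R a b)"
      using S.m_closed by (simp add: eq)
  qed (use sub S.one_closed in auto)
qed

section \<open>Lie algebra and exponential map\<close>

text \<open>
  The real group is a closed linear group, namely a closed subgroup of the unit group of the real
  quaternion algebra.  Its Lie algebra is its tangent space at the identity, and its exponential
  map is the restriction of the exponential series of the algebra.
\<close>

definition lie_algebra :: "nat \<Rightarrow> nat \<Rightarrow> quat set" where
  "lie_algebra a b =
     {X. \<exists>\<gamma>. (\<forall>t::real. \<gamma> t \<in> carrier (SL1 UNIV a b)) \<and> \<gamma> 0 = \<one>\<^bsub>SL1 UNIV a b\<^esub> \<and>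
             (\<gamma> has_vector_derivative X) (at 0)}"

lemma lie_algebra_eq: "lie_algebra a b = {X. fst X = 0}"
proof (intro subset_antisym subsetI)
  fix X assume "X \<in> lie_algebra a b"
  moreover obtain x y z w where X: "X = (x, y, z, w)" by (cases X)
  ultimately obtain \<gamma> where \<gamma>: "\<And>t::real. nred a b (\<gamma> t) = 1" "\<gamma> 0 = (1, 0, 0, 0)"
    and d: "(\<gamma> has_vector_derivative (x, y, z, w)) (at 0)"
    by (auto simp: lie_algebra_def SL1_def)
  define p q r s where "p t = fst (\<gamma> t)" and "q t = fst (snd (\<gamma> t))"
    and "r t = fst (snd (snd (\<gamma> t)))" and "s t = snd (snd (snd (\<gamma> t)))" for t
  have d0: "p 0 = 1" "q 0 = 0" "r 0 = 0" "s 0 = 0"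
    by (simp_all add: p_def q_def r_def s_def \<gamma>)
  have "(p has_real_derivative x) (at 0)" "(q has_real_derivative y) (at 0)"
    "(r has_real_derivative z) (at 0)" "(s has_real_derivative w) (at 0)"
    using bounded_linear.has_vector_derivative[OF bounded_linear_fst d]
      bounded_linear.has_vector_derivative[OF bounded_linear_compose[OF bounded_linear_fst bounded_linear_snd] d]
      bounded_linear.has_vector_derivative[OF bounded_linear_compose[OF bounded_linear_fst
        bounded_linear_compose[OF bounded_linear_snd bounded_linear_snd]] d]
      bounded_linear.has_vector_derivative[OF bounded_linear_compose[OF bounded_linear_snd
        bounded_linear_compose[OF bounded_linear_snd bounded_linear_snd]] d]
    by (simp_all add: p_def[abs_def] q_def[abs_def] r_def[abs_def] s_def[abs_def]
        has_real_derivative_iff_has_vector_derivative)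
  then have "((\<lambda>t. (p t)\<^sup>2 - a * (q t)\<^sup>2 - b * (r t)\<^sup>2 + a * b * (s t)\<^sup>2)
      has_real_derivative 2 * x) (at 0)"
    by (auto intro!: derivative_eq_intros simp: d0)
  moreover have "(\<lambda>t. (p t)\<^sup>2 - a * (q t)\<^sup>2 - b * (r t)\<^sup>2 + a * b * (s t)\<^sup>2) = (\<lambda>t. 1)"
  proof
    fix t
    have "\<gamma> t = (p t, q t, r t, s t)"
      by (simp add: p_def q_def r_def s_def)
    then show "(p t)\<^sup>2 - a * (q t)\<^sup>2 - b * (r t)\<^sup>2 + a * b * (s t)\<^sup>2 = 1"
      using \<gamma>(1)[of t] by simp
  qed
  ultimately have "x = 0"
    using DERIV_unique[OF _ DERIV_const] by fastforce
  then show "X \<in> {X. fst X = 0}"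
    by (simp add: X)
next
  fix X :: quat assume "X \<in> {X. fst X = 0}"
  then obtain y z w where X: "X = (0, y, z, w)" by (cases X) simp
  define D where "D = a * y\<^sup>2 + b * z\<^sup>2 - a * b * w\<^sup>2"
  define f where "f t = t / (1 + \<bar>D\<bar> * t\<^sup>2)" for t :: real
  define \<gamma> where "\<gamma> t = (sqrt (1 + (f t)\<^sup>2 * D), f t * y, f t * z, f t * w)" for t
  have pos: "1 + \<bar>D\<bar> * t\<^sup>2 > 0" for t
    by (simp add: add_pos_nonneg)
  have nn: "1 + (f t)\<^sup>2 * D \<ge> 0" for t
  proof -
    let ?u = "\<bar>D\<bar> * t\<^sup>2"
    have "?u * 1 \<le> 1 * (1 + ?u)\<^sup>2"
      using abs_ge_zero[of D] zero_le_power2[of t]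
      by (auto simp: power2_sum intro!: add_nonneg_nonneg)
    then have "(f t)\<^sup>2 * \<bar>D\<bar> \<le> 1"
      using pos[of t] by (simp add: f_def power_divide divide_le_eq mult.commute)
    then have "\<bar>(f t)\<^sup>2 * D\<bar> \<le> 1"
      by (simp add: abs_mult)
    then show ?thesis
      by linarith
  qed
  have df: "(f has_real_derivative 1) (at 0)"
    unfolding f_def[abs_def] by (auto intro!: derivative_eq_intros)
  have f0: "f 0 = 0"
    by (simp add: f_def)
  have "(\<gamma> has_vector_derivative (0, y, z, w)) (at 0)"
    unfolding \<gamma>_def[abs_def]
    by (intro has_vector_derivative_Pair;
        unfold has_real_derivative_iff_has_vector_derivative[symmetric])
      (auto intro!: derivative_eq_intros df simp: f0)
  moreover have "\<gamma> t \<in> carrier (SL1 UNIV a b)" for t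
    using nn[of t] by (simp add: \<gamma>_def SL1_def quat_ring_def D_def algebra_simps power_mult_distrib)
  moreover have "\<gamma> 0 = \<one>\<^bsub>SL1 UNIV a b\<^esub>"
    by (simp add: \<gamma>_def f0 SL1_def)
  ultimately show "X \<in> lie_algebra a b"
    unfolding lie_algebra_def X by blast
qed

definition qexp :: "nat \<Rightarrow> nat \<Rightarrow> quat \<Rightarrow> quat" where
  "qexp a b X = (\<Sum>n. (X [^]\<^bsub>quat_ring UNIV a b\<^esub> n) /\<^sub>R fact n)"

lemma bounded_bilinear_qmult: "bounded_bilinear (qmult a b)"
proof -
  have "bilinear (qmult a b)"
    unfolding bilinear_def
    by (intro conjI allI linearI) (auto simp: algebra_simps)
  then show ?thesis
    by (simp add: bilinear_conv_bounded_bilinear)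
qed

lemma qexp_sums: "(\<lambda>n. (X [^]\<^bsub>quat_ring UNIV a b\<^esub> n) /\<^sub>R fact n) sums qexp a b X"
proof -
  obtain K where K: "K > 0" "\<And>g h. norm (qmult a b g h) \<le> norm g * norm h * K"
    using bounded_bilinear.pos_bounded[OF bounded_bilinear_qmult] by metis
  have bound: "norm (X [^]\<^bsub>quat_ring UNIV a b\<^esub> n) \<le> (norm X * K) ^ n" for n :: nat
  proof (induction n)
    case 0
    then show ?case by (simp add: quat_ring_def norm_Pair)
  next
    case (Suc n)
    have "norm (X [^]\<^bsub>quat_ring UNIV a b\<^esub> Suc n)
        = norm (qmult a b (X [^]\<^bsub>quat_ring UNIV a b\<^esub> n) X)"
      by (simp add: quat_ring_def)
    also have "\<dots> \<le> norm (X [^]\<^bsub>quat_ring UNIV a b\<^esub> n) * (norm X * K)"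
      using K(2) by (simp add: mult.assoc)
    also have "\<dots> \<le> (norm X * K) ^ n * (norm X * K)"
      using Suc K(1) by (intro mult_right_mono) auto
    finally show ?case by (simp add: mult.commute)
  qed
  have "summable (\<lambda>n. (X [^]\<^bsub>quat_ring UNIV a b\<^esub> n) /\<^sub>R fact n)"
  proof (rule summable_comparison_test'[OF summable_exp[of "norm X * K"], of 0])
    show "norm ((X [^]\<^bsub>quat_ring UNIV a b\<^esub> n) /\<^sub>R fact n) \<le> inverse (fact n) * (norm X * K) ^ n"
      for n :: nat
      using bound[of n] by (simp add: mult_left_mono)
  qed
  then show ?thesis
    unfolding qexp_def by (rule summable_sums)
qed

section \<open>Homogeneous spaces and cocompact lattices\<close>

definition coset_topology ::
  "('a::topological_space, 'm) monoid_scheme \<Rightarrow> 'a set \<Rightarrow> 'a set topology" where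
  "coset_topology G \<Gamma> =
     topology (\<lambda>U. U \<subseteq> lcosets\<^bsub>G\<^esub> \<Gamma> \<and>
       openin (top_of_set (carrier G)) {g \<in> carrier G. g <#\<^bsub>G\<^esub> \<Gamma> \<in> U})"

lemma openin_coset_topology:
  "openin (coset_topology G \<Gamma>) U \<longleftrightarrow>
     U \<subseteq> lcosets\<^bsub>G\<^esub> \<Gamma> \<and> openin (top_of_set (carrier G)) {g \<in> carrier G. g <#\<^bsub>G\<^esub> \<Gamma> \<in> U}"
proof -
  let ?P = "\<lambda>U. {g \<in> carrier G. g <#\<^bsub>G\<^esub> \<Gamma> \<in> U}"
  have Int: "?P (S \<inter> T) = ?P S \<inter> ?P T" for S T
    by auto
  have Union: "?P (\<Union>\<K>) = \<Union>(?P ` \<K>)" for \<K>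
    by auto
  have "istopology (\<lambda>U. U \<subseteq> lcosets\<^bsub>G\<^esub> \<Gamma> \<and> openin (top_of_set (carrier G)) (?P U))"
    unfolding istopology_def Int Union by (blast intro: openin_Int openin_Union)
  then show ?thesis
    by (simp add: coset_topology_def)
qed

text \<open>
  A discrete subgroup with compact quotient; such a subgroup has finite covolume, so it is a lattice.
\<close>

definition cocompact_lattice ::
  "'a::topological_space set \<Rightarrow> ('a, 'm) monoid_scheme \<Rightarrow> bool" where
  "cocompact_lattice \<Gamma> G \<longleftrightarrow>
     subgroup \<Gamma> G \<and> discrete \<Gamma> \<and> compact_space (coset_topology G \<Gamma>)"

section \<open>Blocking\<close>

text \<open>
  The points of \<open>G/\<Gamma>\<close> are left cosets, and \<open>g <#\<^bsub>G\<^esub> m\<close> is the left translate of the point \<open>m\<close>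
  by \<open>g\<close>.  Only the values of \<open>c\<close> on \<open>[0, 1]\<close> are relevant; the constant curve (\<open>X = 0\<close>) counts
  as a connecting curve when \<open>m\<^sub>1 = m\<^sub>2\<close>.
\<close>

definition connecting_curve ::
  "nat \<Rightarrow> nat \<Rightarrow> quat set \<Rightarrow> quat set \<Rightarrow> quat set \<Rightarrow> (real \<Rightarrow> quat set) \<Rightarrow> bool" where
  "connecting_curve a b \<Gamma> m\<^sub>1 m\<^sub>2 c \<longleftrightarrow>
     (\<exists>X\<in>lie_algebra a b. \<exists>m\<in>lcosets\<^bsub>SL1 UNIV a b\<^esub> \<Gamma>.
        \<forall>t\<in>{0..1}. c t = qexp a b (t *\<^sub>R X) <#\<^bsub>SL1 UNIV a b\<^esub> m) \<and>
     c 0 = m\<^sub>1 \<and> c 1 = m\<^sub>2"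

definition blocking_set ::
  "nat \<Rightarrow> nat \<Rightarrow> quat set \<Rightarrow> quat set \<Rightarrow> quat set \<Rightarrow> quat set set \<Rightarrow> bool" where
  "blocking_set a b \<Gamma> m\<^sub>1 m\<^sub>2 B \<longleftrightarrow>
     finite B \<and> B \<subseteq> (lcosets\<^bsub>SL1 UNIV a b\<^esub> \<Gamma>) - {m\<^sub>1, m\<^sub>2} \<and>
     (\<forall>c. connecting_curve a b \<Gamma> m\<^sub>1 m\<^sub>2 c \<longrightarrow> c ` {0..1} \<inter> B \<noteq> {})"

definition blockable :: "nat \<Rightarrow> nat \<Rightarrow> quat set \<Rightarrow> quat set \<Rightarrow> quat set \<Rightarrow> bool" where
  "blockable a b \<Gamma> m\<^sub>1 m\<^sub>2 \<longleftrightarrow> (\<exists>B. blocking_set a b \<Gamma> m\<^sub>1 m\<^sub>2 B)"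

definition blockable_space :: "nat \<Rightarrow> nat \<Rightarrow> quat set \<Rightarrow> bool" where
  "blockable_space a b \<Gamma> \<longleftrightarrow>
     (\<forall>m\<^sub>1\<in>lcosets\<^bsub>SL1 UNIV a b\<^esub> \<Gamma>. \<forall>m\<^sub>2\<in>lcosets\<^bsub>SL1 UNIV a b\<^esub> \<Gamma>. blockable a b \<Gamma> m\<^sub>1 m\<^sub>2)"

end

theory Submission
  imports Defs
begin

text \<open>
  Cocompactness forces \<open>a\<close> and \<open>b\<close> to be nonsquares, so Pell's equation gives units \<open>P + Qi\<close> with
  \<open>P\<close> arbitrarily large and a unit \<open>r + sj\<close> of \<open>\<Gamma>\<close>.  The elements
  \<open>T = (x + yi)(P + Qi)(r + sj) = (X + Yi)(r + sj)\<close> lie in the coset of \<open>g = x + yi\<close> and are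
  hyperbolic; the connecting curve through \<open>T\<close> passes through the elements \<open>\<alpha> + \<beta> T\<close> with
  \<open>\<alpha>, \<beta> > 0\<close>.  A finite blocking set has a point \<open>M\<close> that meets infinitely many of these curves.
  As different \<open>T\<close> have nonproportional imaginary parts, two elements \<open>\<alpha> + \<beta> T\<close> of \<open>M\<close> can only
  differ by an element of \<open>\<Gamma>\<close> when \<open>\<alpha> / \<beta>\<close> is rational, and then \<open>K M\<close> consists of integral
  quaternions for some \<open>K > 0\<close>.  Integrality of \<open>K (\<alpha> + \<beta> T)\<close> bounds \<open>K \<alpha>\<close> and \<open>K \<beta>\<close> from below
  independently of \<open>T\<close>, so the reduced norm \<open>K\<^sup>2 (\<alpha>\<^sup>2 + \<beta>\<^sup>2 + 2 \<alpha> \<beta> X r)\<close> tends to infinity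
  with \<open>X\<close>, although it is constant on \<open>K M\<close>.
\<close>

section \<open>Pell's equation\<close>

lemma sqrt_nat_irrational:
  fixes a :: nat
  assumes "\<And>m::nat. a \<noteq> m\<^sup>2"
  shows "sqrt a \<notin> \<rat>"
proof
  assume "sqrt a \<in> \<rat>"
  then obtain h k :: int where hk: "sqrt a = h / k" "k > 0" "coprime h k"
    by (meson Rats_cases')
  then have "real a * (real_of_int k)\<^sup>2 = (real_of_int h)\<^sup>2"
    by (metis less_irrefl nonzero_mult_div_cancel_right of_int_eq_0_iff of_nat_0_le_iff
        power_mult_distrib real_sqrt_pow2 times_divide_eq_left)
  then have "of_int (int a * k\<^sup>2) = (of_int (h\<^sup>2) :: real)"
    by simp
  then have eq: "int a * k\<^sup>2 = h\<^sup>2"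
    by (simp only: of_int_eq_iff)
  then have "k\<^sup>2 dvd h\<^sup>2"
    by (metis dvd_triv_right)
  then have "k dvd h"
    by simp
  then have "k = 1"
    using hk by (metis coprime_common_divisor dvd_refl int_one_le_iff_zero_less zdvd1_eq abs_of_pos)
  then have "int a = int ((nat \<bar>h\<bar>)\<^sup>2)"
    using eq by simp
  then show False
    using assms of_nat_eq_iff by blast
qed

lemma infinite_fiber_two:
  assumes "infinite A" "finite (f ` A)"
  obtains x y where "x \<in> A" "y \<in> A" "x \<noteq> y" "f x = f y"
  using assms inj_on_def finite_imageD by metis

text \<open>The approximations \<open>h / k\<close> of \<open>sqrt a\<close> give infinitely many values of \<open>h\<^sup>2 - a k\<^sup>2\<close> in a
  bounded range; two of them that agree modulo the common value have a quotient that solves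
  Pell's equation.\<close>

lemma pell_nontrivial:
  fixes a :: nat
  assumes "\<And>m::nat. a \<noteq> m\<^sup>2"
  obtains p q :: int where "p\<^sup>2 - int a * q\<^sup>2 = 1" "q \<noteq> 0"
proof -
  define \<theta> where "\<theta> = sqrt a"
  have irr: "\<theta> \<notin> \<rat>"
    unfolding \<theta>_def by (rule sqrt_nat_irrational[OF assms])
  have \<theta>2: "\<theta>\<^sup>2 = a" "\<theta> \<ge> 0"
    by (simp_all add: \<theta>_def)
  \<comment> \<open>Bounds \<open>e\<^sup>2 + 2 * \<theta> * \<bar>e\<bar> * k\<close> for the error
    \<open>e = \<theta> * k - h\<close> of an approximation, since both \<open>\<bar>e\<bar>\<close>
    and \<open>\<bar>e\<bar> * k\<close> are at most 1.\<close>
  define C where "C = \<lceil>1 + 2 * \<theta>\<rceil>"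
  define n where "n = (\<lambda>(h::int, k::int). h\<^sup>2 - int a * k\<^sup>2)"
  define f where "f = (\<lambda>(h::int, k::int). (n (h, k), h mod n (h, k), k mod n (h, k)))"
  have n0: "n (h, k) \<noteq> 0" if "(h, k) \<in> approx_set \<theta>" for h k
  proof
    assume "n (h, k) = 0"
    then have "of_int (h\<^sup>2) = (of_int (int a * k\<^sup>2) :: real)"
      by (simp add: n_def)
    then have "(of_int h)\<^sup>2 = (\<theta> * of_int k)\<^sup>2"
      by (simp add: power_mult_distrib \<theta>2)
    then have "\<bar>of_int h\<bar> = \<theta> * of_int k"
      using power2_eq_iff_nonneg[of "\<bar>of_int h\<bar>" "\<theta> * of_int k"] \<theta>2(2) that
      by (simp add: approx_set_def)
    moreover have "k > 0"
      using that by (simp add: approx_set_def)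
    ultimately have "\<theta> = of_int \<bar>h\<bar> / of_int k"
      by (simp add: field_simps)
    then show False
      using irr by (metis Rats_divide Rats_of_int)
  qed
  have nC: "\<bar>n (h, k)\<bar> \<le> C" if "(h, k) \<in> approx_set \<theta>" for h k
  proof -
    have k: "k > 0" "\<bar>\<theta> - of_int h / of_int k\<bar> < 1 / (of_int k)\<^sup>2"
      using that by (auto simp: approx_set_def)
    have k1: "of_int k \<ge> (1::real)"
      using k by simp
    define e where "e = \<theta> * of_int k - of_int h"
    have "e = of_int k * (\<theta> - of_int h / of_int k)"
      using k1 by (simp add: e_def field_simps)
    then have "\<bar>e\<bar> = of_int k * \<bar>\<theta> - of_int h / of_int k\<bar>"
      using k1 by (simp add: abs_mult)
    then have ek: "\<bar>e\<bar> * of_int k \<le> 1"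
      using k k1 by (simp add: field_simps power2_eq_square)
    have "\<bar>e\<bar> * 1 \<le> \<bar>e\<bar> * of_int k"
      using k1 by (intro mult_left_mono) auto
    then have e1: "\<bar>e\<bar> \<le> 1"
      using ek by simp
    have "of_int (n (h, k)) = (of_int h)\<^sup>2 - \<theta>\<^sup>2 * (of_int k)\<^sup>2"
      by (simp add: n_def \<theta>2)
    also have "\<dots> = e\<^sup>2 - 2 * \<theta> * (e * of_int k)"
      by (simp add: e_def power2_eq_square algebra_simps)
    finally have "\<bar>of_int (n (h, k))\<bar> \<le> \<bar>e\<bar>\<^sup>2 + 2 * \<theta> * (\<bar>e\<bar> * of_int k)"
      using abs_triangle_ineq4[of "e\<^sup>2" "2 * \<theta> * (e * of_int k)"] \<theta>2(2) k1
      by (simp add: abs_mult)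
    also have "\<dots> \<le> 1 + 2 * \<theta> * 1"
      using e1 ek \<theta>2(2) by (intro add_mono mult_left_mono) (auto simp: abs_square_le_1)
    finally show ?thesis
      unfolding C_def by linarith
  qed
  \<comment> \<open>Residues modulo \<open>n (h, k)\<close> are smaller than
    \<open>\<bar>n (h, k)\<bar>\<close>, so the same \<open>C\<close> bounds all three
    components.\<close>
  have "f ` approx_set \<theta> \<subseteq> {-C..C} \<times> {-C..C} \<times> {-C..C}"
  proof (clarsimp simp: f_def)
    fix h k assume hk: "(h, k) \<in> approx_set \<theta>"
    have "\<bar>h mod n (h, k)\<bar> < \<bar>n (h, k)\<bar>" "\<bar>k mod n (h, k)\<bar> < \<bar>n (h, k)\<bar>"
      using n0[OF hk] abs_mod_less by blast+
    then show "- C \<le> n (h, k) \<and> n (h, k) \<le> C \<and> - C \<le> h mod n (h, k) \<and> h mod n (h, k) \<le> C \<and>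
        - C \<le> k mod n (h, k) \<and> k mod n (h, k) \<le> C"
      using nC[OF hk] by linarith
  qed
  then have "finite (f ` approx_set \<theta>)"
    by (rule finite_subset) auto
  moreover have "infinite (approx_set \<theta>)"
    using irr rational_iff_finite_approx_set by blast
  ultimately obtain h k h' k' where A: "(h, k) \<in> approx_set \<theta>" "(h', k') \<in> approx_set \<theta>"
    and ne: "(h, k) \<noteq> (h', k')" and f: "f (h, k) = f (h', k')"
    by (metis infinite_fiber_two surj_pair)
  define N where "N = n (h, k)"
  have N: "N \<noteq> 0" "h\<^sup>2 - int a * k\<^sup>2 = N" "h'\<^sup>2 - int a * k'\<^sup>2 = N"
    and m: "h mod N = h' mod N" "k mod N = k' mod N"
    using n0[OF A(1)] f by (auto simp: N_def f_def n_def)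
  obtain s t where s: "h' = h + N * s" and t: "k' = k + N * t"
    using m by (metis mod_eqE mult.commute)
  \<comment> \<open>With \<omega> = sqrt a, p + q\<omega> is the quotient (h' + k'\<omega>) / (h +
    k\<omega>) = (h' + k'\<omega>)(h - k\<omega>) / N. The congruences modulo N make it integral,
    and equal norms of numerator and denominator give it norm 1.\<close>
  define p q where "p = 1 + h * s - int a * k * t" and "q = h * t - k * s"
  have Np: "N * p = h * h' - int a * k * k'"
    unfolding p_def s t using N(2) by (simp add: algebra_simps power2_eq_square)
  have Nq: "N * q = h * k' - k * h'"
    unfolding q_def s t by (simp add: algebra_simps)
  have "N\<^sup>2 * (p\<^sup>2 - int a * q\<^sup>2) = (N * p)\<^sup>2 - int a * (N * q)\<^sup>2"
    by (simp add: algebra_simps)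
  also have "\<dots> = (h\<^sup>2 - int a * k\<^sup>2) * (h'\<^sup>2 - int a * k'\<^sup>2)"
    unfolding Np Nq by (simp add: algebra_simps power2_eq_square)
  also have "\<dots> = N\<^sup>2 * 1"
    unfolding N(2,3) by (simp add: power2_eq_square)
  finally have "p\<^sup>2 - int a * q\<^sup>2 = 1"
    using N(1) by simp
  \<comment> \<open>Otherwise h / k = h' / k', and two equal fractions in lowest terms with positive
    denominators have the same entries.\<close>
  moreover have "q \<noteq> 0"
  proof
    assume "q = 0"
    then have eq: "h * k' = h' * k"
      using Nq by (simp add: mult.commute)
    have c: "k > 0" "k' > 0" "coprime h k" "coprime h' k'"
      using A by (auto simp: approx_set_def)
    have "k dvd h * k'" "k' dvd h' * k"
      using eq by (metis dvd_triv_right)+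
    then have "k dvd k'" "k' dvd k"
      using c by (metis coprime_commute coprime_dvd_mult_right_iff)+
    then have "k = k'"
      using c by (simp add: zdvd_antisym_nonneg)
    then show False
      using eq c ne by simp
  qed
  ultimately show thesis
    by (rule that)
qed

text \<open>Multiplying a solution by a fixed one with \<open>p1 \<ge> 1\<close> and
  \<open>q1 > 0\<close> preserves the norm 1 by Brahmagupta's identity and raises \<open>p\<close>
  by at least 1, so induction on the bound works.\<close>

lemma pell_large:
  fixes a K :: nat
  assumes "\<And>m::nat. a \<noteq> m\<^sup>2"
  obtains p q :: int where "p\<^sup>2 - int a * q\<^sup>2 = 1" "p > int K" "q > 0"
proof -
  obtain p1 q1 :: int where 1: "p1\<^sup>2 - int a * q1\<^sup>2 = 1" "p1 \<ge> 0" "q1 > 0"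
  proof -
    obtain p q :: int where "p\<^sup>2 - int a * q\<^sup>2 = 1" "q \<noteq> 0"
      by (rule pell_nontrivial[OF assms])
    then show ?thesis
      by (intro that[of "\<bar>p\<bar>" "\<bar>q\<bar>"]) auto
  qed
  have a: "a > 0"
    using assms[of 0] by auto
  have "p1 \<noteq> 0"
  proof
    assume "p1 = 0"
    then have "int a * q1\<^sup>2 = - 1"
      using 1(1) by simp
    moreover have "int a * q1\<^sup>2 \<ge> 0"
      by simp
    ultimately show False
      by linarith
  qed
  with 1 have p1: "p1 \<ge> 1"
    by simp
  have "\<exists>p q :: int. p\<^sup>2 - int a * q\<^sup>2 = 1 \<and> p > int K \<and> q > 0"
  proof (induction K)
    case 0
    then show ?case
      using 1 p1 by (intro exI[of _ p1] exI[of _ q1]) auto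
  next
    case (Suc K)
    then obtain p q :: int where pq: "p\<^sup>2 - int a * q\<^sup>2 = 1" "p > int K" "q > 0"
      by blast
    have "(p1 * p + int a * q1 * q)\<^sup>2 - int a * (p1 * q + q1 * p)\<^sup>2
        = (p1\<^sup>2 - int a * q1\<^sup>2) * (p\<^sup>2 - int a * q\<^sup>2)"
      by (simp add: algebra_simps power2_eq_square)
    then have "(p1 * p + int a * q1 * q)\<^sup>2 - int a * (p1 * q + q1 * p)\<^sup>2 = 1"
      by (simp add: 1 pq)
    moreover have "p1 * p + int a * q1 * q > int (Suc K)"
    proof -
      have "1 * p \<le> p1 * p"
        using p1 pq by (intro mult_right_mono) auto
      moreover have "0 < int a * q1 * q"
        using a 1 pq by simp
      ultimately show ?thesis
        using pq(2) by linarith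
    qed
    moreover have "p1 * q + q1 * p > 0"
      using p1 1 pq by (intro add_pos_pos) auto
    ultimately have "\<exists>q'. (p1 * p + int a * q1 * q)\<^sup>2 - int a * q'\<^sup>2 = 1 \<and>
        p1 * p + int a * q1 * q > int (Suc K) \<and> q' > 0"
      by blast
    then show ?case
      by blast
  qed
  then show thesis
    using that by blast
qed

section \<open>Consequences of cocompactness\<close>

text \<open>Quaternion conjugation, which serves as an explicit inverse on elements of reduced norm
  1.\<close>

definition qconj :: "quat \<Rightarrow> quat" where
  "qconj = (\<lambda>(x, y, z, w). (x, - y, - z, - w))"

lemma qmult_qconj:
  "qmult a b (qconj g) g = (nred a b g, 0, 0, 0)"
  by (cases g) (simp add: qconj_def power2_eq_square)

lemma qmult_qconj_right:
  "qmult a b g (qconj g) = (nred a b g, 0, 0, 0)"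
  by (cases g) (simp add: qconj_def power2_eq_square)

lemma norm_qconj: "norm (qconj g) = norm g"
  by (cases g) (simp add: qconj_def norm_Pair)

lemma carrier_SL1:
  "(x, y, z, w) \<in> carrier (SL1 R a b) \<longleftrightarrow>
     x \<in> R \<and> y \<in> R \<and> z \<in> R \<and> w \<in> R \<and> x\<^sup>2 - a * y\<^sup>2 - b * z\<^sup>2 + a * b * w\<^sup>2 = 1"
  by (auto simp: SL1_def quat_ring_def)

lemma nred_SL1: "g \<in> carrier (SL1 R a b) \<Longrightarrow> nred a b g = 1"
  by (simp add: SL1_def)

lemma qconj_qmult_cancel:
  assumes "nred a b g = 1"
  shows "qmult a b (qconj g) (qmult a b g h) = h"
  using assms by (cases h) (simp flip: qmult_assoc add: qmult_qconj)

lemma l_coset_SL1: "g <#\<^bsub>SL1 R a b\<^esub> H = qmult a b g ` H"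
  by (auto simp: l_coset_def SL1_def)

text \<open>The images of the norm balls form an open cover of the compact quotient. The largest
  radius in a finite subcover bounds a representative of every coset.\<close>

lemma cocompact_bounded_representatives:
  assumes "\<Gamma> = carrier (SL1 \<int> a b)" "cocompact_lattice \<Gamma> (SL1 UNIV a b)"
  obtains C where "\<And>g. g \<in> carrier (SL1 UNIV a b) \<Longrightarrow>
    \<exists>c\<in>carrier (SL1 UNIV a b). \<exists>d\<in>\<Gamma>. g = qmult a b c d \<and> norm c \<le> C"
proof -
  interpret G: group "SL1 UNIV a b"
    by (rule group_SL1) simp
  have sub: "subgroup \<Gamma> (SL1 UNIV a b)"
    using assms(2) by (simp add: cocompact_lattice_def)
  define X where "X = coset_topology (SL1 UNIV a b) \<Gamma>"
  define U where "U r = (\<lambda>g. g <#\<^bsub>SL1 UNIV a b\<^esub> \<Gamma>) ` {g \<in> carrier (SL1 UNIV a b). norm g < r}"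
    for r :: real
  have U_subset: "U r \<subseteq> lcosets\<^bsub>SL1 UNIV a b\<^esub> \<Gamma>" for r
    by (auto simp: U_def LCOSETS_def)
  \<comment> \<open>This describes the preimage of \<open>U r\<close> in the group as a union over
    \<open>d\<close> in \<Gamma> of open conditions on \<open>g\<close>, hence as an open
    set.\<close>
  have U_iff: "g <#\<^bsub>SL1 UNIV a b\<^esub> \<Gamma> \<in> U r \<longleftrightarrow> (\<exists>d\<in>\<Gamma>. norm (qmult a b g d) < r)"
    if g: "g \<in> carrier (SL1 UNIV a b)" for g r
  proof
    assume "g <#\<^bsub>SL1 UNIV a b\<^esub> \<Gamma> \<in> U r"
    then obtain h where h: "h \<in> carrier (SL1 UNIV a b)" "norm h < r"
        "g <#\<^bsub>SL1 UNIV a b\<^esub> \<Gamma> = h <#\<^bsub>SL1 UNIV a b\<^esub> \<Gamma>"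
      by (auto simp: U_def)
    have "h \<in> g <#\<^bsub>SL1 UNIV a b\<^esub> \<Gamma>"
      using G.lcos_self[OF h(1) sub] h(3) by simp
    then show "\<exists>d\<in>\<Gamma>. norm (qmult a b g d) < r"
      using h(2) by (auto simp: l_coset_SL1)
  next
    assume "\<exists>d\<in>\<Gamma>. norm (qmult a b g d) < r"
    then obtain d where d: "d \<in> \<Gamma>" "norm (qmult a b g d) < r"
      by blast
    have mem: "qmult a b g d \<in> g <#\<^bsub>SL1 UNIV a b\<^esub> \<Gamma>"
      using d by (auto simp: l_coset_SL1)
    then have "qmult a b g d \<in> carrier (SL1 UNIV a b)"
      using subgroup.elemlcos_carrier[OF sub G.group_axioms g] by blast
    moreover have "g <#\<^bsub>SL1 UNIV a b\<^esub> \<Gamma> = qmult a b g d <#\<^bsub>SL1 UNIV a b\<^esub> \<Gamma>"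
      by (rule G.l_repr_independence[OF mem g sub])
    ultimately show "g <#\<^bsub>SL1 UNIV a b\<^esub> \<Gamma> \<in> U r"
      using d(2) by (auto simp: U_def)
  qed
  have "openin X (U r)" for r
  proof -
    have "open {g. norm (qmult a b g d) < r}" for d
      by (intro open_Collect_less continuous_intros
          bounded_linear.continuous_on[OF bounded_bilinear.bounded_linear_left[OF bounded_bilinear_qmult]])
    then have "openin (top_of_set (carrier (SL1 UNIV a b)))
        (carrier (SL1 UNIV a b) \<inter> (\<Union>d\<in>\<Gamma>. {g. norm (qmult a b g d) < r}))"
      by (intro openin_open_Int open_UN) auto
    also have "carrier (SL1 UNIV a b) \<inter> (\<Union>d\<in>\<Gamma>. {g. norm (qmult a b g d) < r})
        = {g \<in> carrier (SL1 UNIV a b). g <#\<^bsub>SL1 UNIV a b\<^esub> \<Gamma> \<in> U r}"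
      using U_iff by blast
    finally show ?thesis
      unfolding X_def openin_coset_topology using U_subset by blast
  qed
  moreover have top: "topspace X = lcosets\<^bsub>SL1 UNIV a b\<^esub> \<Gamma>"
  proof
    show "topspace X \<subseteq> lcosets\<^bsub>SL1 UNIV a b\<^esub> \<Gamma>"
      using openin_topspace[of X] unfolding X_def openin_coset_topology by blast
    show "lcosets\<^bsub>SL1 UNIV a b\<^esub> \<Gamma> \<subseteq> topspace X"
    proof
      fix m assume "m \<in> lcosets\<^bsub>SL1 UNIV a b\<^esub> \<Gamma>"
      then obtain g where "g \<in> carrier (SL1 UNIV a b)" "m = g <#\<^bsub>SL1 UNIV a b\<^esub> \<Gamma>"
        by (auto simp: LCOSETS_def)
      then have "m \<in> U (norm g + 1)"
        by (auto simp: U_def)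
      then show "m \<in> topspace X"
        using openin_subset[OF \<open>\<And>r. openin X (U r)\<close>] by blast
    qed
  qed
  moreover have "lcosets\<^bsub>SL1 UNIV a b\<^esub> \<Gamma> \<subseteq> \<Union>(range U)"
  proof
    fix m assume "m \<in> lcosets\<^bsub>SL1 UNIV a b\<^esub> \<Gamma>"
    then obtain g where "g \<in> carrier (SL1 UNIV a b)" "m = g <#\<^bsub>SL1 UNIV a b\<^esub> \<Gamma>"
      by (auto simp: LCOSETS_def)
    then have "m \<in> U (norm g + 1)"
      by (auto simp: U_def)
    then show "m \<in> \<Union>(range U)"
      by blast
  qed
  moreover have "compact_space X"
    using assms(2) by (simp add: cocompact_lattice_def X_def)
  ultimately obtain F where F: "finite F" "F \<subseteq> range U" "lcosets\<^bsub>SL1 UNIV a b\<^esub> \<Gamma> \<subseteq> \<Union>F"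
    unfolding compact_space_alt by (metis (no_types, lifting) imageE)
  then obtain I where I: "finite I" "F = U ` I"
    by (meson finite_subset_image)
  show thesis
  proof (rule that)
    fix g assume g: "g \<in> carrier (SL1 UNIV a b)"
    then have "g <#\<^bsub>SL1 UNIV a b\<^esub> \<Gamma> \<in> lcosets\<^bsub>SL1 UNIV a b\<^esub> \<Gamma>"
      by (auto simp: LCOSETS_def)
    then obtain r where r: "r \<in> I" "g <#\<^bsub>SL1 UNIV a b\<^esub> \<Gamma> \<in> U r"
      using F(3) I(2) by blast
    then obtain c where c: "c \<in> carrier (SL1 UNIV a b)" "norm c < r"
        "g <#\<^bsub>SL1 UNIV a b\<^esub> \<Gamma> = c <#\<^bsub>SL1 UNIV a b\<^esub> \<Gamma>"
      by (auto simp: U_def)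
    have "g \<in> c <#\<^bsub>SL1 UNIV a b\<^esub> \<Gamma>"
      using G.lcos_self[OF g sub] c(3) by simp
    then obtain d where "d \<in> \<Gamma>" "g = qmult a b c d"
      unfolding l_coset_SL1 by blast
    moreover have "norm c \<le> Max I"
      using c(2) Max_ge[OF I(1) r(1)] by simp
    ultimately show "\<exists>c\<in>carrier (SL1 UNIV a b). \<exists>d\<in>\<Gamma>. g = qmult a b c d \<and> norm c \<le> Max I"
      using c(1) by blast
  qed
qed

lemma integral_quat_small:
  assumes "g \<in> \<int> \<times> \<int> \<times> \<int> \<times> \<int>" "norm (g :: quat) < 1"
  shows "g = 0"
proof -
  obtain x y z w where g: "g = (x, y, z, w)"
    by (cases g)
  have "norm x \<le> norm g" "norm y \<le> norm g" "norm z \<le> norm g" "norm w \<le> norm g"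
    unfolding g by (metis norm_fst_le norm_snd_le fst_conv snd_conv order_trans)+
  then show ?thesis
    using assms by (auto simp: g zero_prod_def Ints_nonzero_abs_less1)
qed

text \<open>Mahler's criterion: cocompactness keeps the integral elements away from the orbits that
  approach \<open>0\<close>.\<close>

lemma cocompact_no_contracted_integral:
  assumes "\<Gamma> = carrier (SL1 \<int> a b)" "cocompact_lattice \<Gamma> (SL1 UNIV a b)"
    and z: "z \<in> \<int> \<times> \<int> \<times> \<int> \<times> \<int>" "z \<noteq> 0"
    and contr: "\<And>s. s > 0 \<Longrightarrow> \<exists>h\<in>carrier (SL1 UNIV a b). qmult a b h z = z /\<^sub>R s"
  shows False
proof -
  obtain C where C: "\<And>g. g \<in> carrier (SL1 UNIV a b) \<Longrightarrow>
    \<exists>c\<in>carrier (SL1 UNIV a b). \<exists>d\<in>\<Gamma>. g = qmult a b c d \<and> norm c \<le> C"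
    using cocompact_bounded_representatives[OF assms(1,2)] by metis
  obtain K where K: "K > 0" "\<And>g h. norm (qmult a b g h) \<le> norm g * norm h * K"
    using bounded_bilinear.pos_bounded[OF bounded_bilinear_qmult] by metis
  \<comment> \<open>Large enough that contraction by 1 / s outweighs multiplication by the inverse
    of any \<open>c\<close> with \<open>norm c \<le> C\<close>.\<close>
  define s where "s = \<bar>C\<bar> * norm z * K + 1"
  have s: "s > 0" "\<bar>C\<bar> * norm z * K < s"
    using K(1) by (simp_all add: s_def add_nonneg_pos)
  obtain h where h: "h \<in> carrier (SL1 UNIV a b)" "qmult a b h z = z /\<^sub>R s"
    using contr[OF s(1)] by blast
  obtain c d where cd: "c \<in> carrier (SL1 UNIV a b)" "d \<in> \<Gamma>" "h = qmult a b c d" "norm c \<le> C"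
    using C[OF h(1)] by blast
  \<comment> \<open>Here \<open>d\<close> is the inverse of \<open>c\<close> times \<open>h\<close>,
    so \<open>d z\<close> is both integral and of norm below 1; it vanishes, although
    \<open>d\<close> is invertible and \<open>z\<close> is nonzero.\<close>
  have "qmult a b d z = qmult a b (qconj c) (qmult a b h z)"
    unfolding cd(3) qmult_assoc by (simp add: qconj_qmult_cancel nred_SL1[OF cd(1)])
  also have "norm \<dots> \<le> norm c * norm z * K / s"
    unfolding h(2) using K(2)[of "qconj c" "z /\<^sub>R s"] s(1) by (simp add: norm_qconj divide_simps)
  also have "\<dots> \<le> \<bar>C\<bar> * norm z * K / s"
    using cd(4) K(1) s(1) by (intro divide_right_mono mult_right_mono) auto
  also have "\<dots> < 1"
    using s by simp
  finally have "norm (qmult a b d z) < 1" .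
  moreover have "qmult a b d z \<in> \<int> \<times> \<int> \<times> \<int> \<times> \<int>"
    using cd(2) z(1) by (cases d; cases z) (auto simp: assms(1) carrier_SL1)
  ultimately have "qmult a b d z = 0"
    by (intro integral_quat_small)
  then have "z = qmult a b (qconj d) 0"
    using qconj_qmult_cancel[of a b d z] cd(2) by (simp add: assms(1) nred_SL1)
  then show False
    using z(2) bounded_bilinear.zero_right[OF bounded_bilinear_qmult] by simp
qed

text \<open>If a = m^2, then i (m - i) = -m (m - i), so left multiplication by u + vi scales the
  integral zero divisor m - i by u - mv. The elements \<open>?h\<close> have reduced norm 1 and
  scaling factor 1 / s. For b the same works with j in place of i.\<close>

lemma cocompact_nonsquare:
  assumes "\<Gamma> = carrier (SL1 \<int> a b)" "cocompact_lattice \<Gamma> (SL1 UNIV a b)" "a > 0" "b > 0"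
  shows "a \<noteq> m\<^sup>2" "b \<noteq> m\<^sup>2"
proof -
  show "a \<noteq> m\<^sup>2"
  proof
    assume a: "a = m\<^sup>2"
    then have m: "m > 0"
      using assms(3) by (cases m) auto
    show False
    proof (rule cocompact_no_contracted_integral[OF assms(1,2), of "(real m, -1, 0, 0)"])
      fix s :: real assume s: "s > 0"
      let ?h = "((s + 1 / s) / 2, (s - 1 / s) / (2 * m), 0, 0) :: quat"
      have "?h \<in> carrier (SL1 UNIV a b)"
        using s m by (simp add: carrier_SL1 a field_simps power2_eq_square)
      moreover have "qmult a b ?h (real m, -1, 0, 0) = (real m, -1, 0, 0) /\<^sub>R s"
        using s m by (simp add: a field_simps power2_eq_square)
      ultimately show "\<exists>h\<in>carrier (SL1 UNIV a b).
          qmult a b h (real m, -1, 0, 0) = (real m, -1, 0, 0) /\<^sub>R s"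
        by blast
    qed (auto simp: zero_prod_def)
  qed
  show "b \<noteq> m\<^sup>2"
  proof
    assume b: "b = m\<^sup>2"
    then have m: "m > 0"
      using assms(4) by (cases m) auto
    show False
    proof (rule cocompact_no_contracted_integral[OF assms(1,2), of "(real m, 0, -1, 0)"])
      fix s :: real assume s: "s > 0"
      let ?h = "((s + 1 / s) / 2, 0, (s - 1 / s) / (2 * m), 0) :: quat"
      have "?h \<in> carrier (SL1 UNIV a b)"
        using s m by (simp add: carrier_SL1 b field_simps power2_eq_square)
      moreover have "qmult a b ?h (real m, 0, -1, 0) = (real m, 0, -1, 0) /\<^sub>R s"
        using s m by (simp add: b field_simps power2_eq_square)
      ultimately show "\<exists>h\<in>carrier (SL1 UNIV a b).
          qmult a b h (real m, 0, -1, 0) = (real m, 0, -1, 0) /\<^sub>R s"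
        by blast
    qed (auto simp: zero_prod_def)
  qed
qed

section \<open>One-parameter subgroups\<close>

text \<open>The even powers of \<open>V\<close> are 1 and the odd ones are \<open>V\<close>, so the
  exponential series splits into those of cosh and sinh.\<close>

lemma qexp_involution:
  assumes "qmult a b V V = (1, 0, 0, 0)"
  shows "qexp a b (d *\<^sub>R V) = cosh d *\<^sub>R (1, 0, 0, 0) + sinh d *\<^sub>R V"
proof -
  have one: "qmult a b (1, 0, 0, 0) V = V"
    by (cases V) simp
  have pow: "(d *\<^sub>R V) [^]\<^bsub>quat_ring UNIV a b\<^esub> n
      = d ^ n *\<^sub>R (if even n then (1, 0, 0, 0) else V)" for n :: nat
  proof (induction n)
    case 0
    then show ?case by (simp add: quat_ring_def)
  next
    case (Suc n)
    have "(d *\<^sub>R V) [^]\<^bsub>quat_ring UNIV a b\<^esub> Suc n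
        = qmult a b (d ^ n *\<^sub>R (if even n then (1, 0, 0, 0) else V)) (d *\<^sub>R V)"
      using Suc by (simp add: quat_ring_def)
    also have "\<dots> = d ^ Suc n *\<^sub>R qmult a b (if even n then (1, 0, 0, 0) else V) V"
      by (simp only: bounded_bilinear.scaleR_left[OF bounded_bilinear_qmult]
          bounded_bilinear.scaleR_right[OF bounded_bilinear_qmult] scaleR_scaleR power_Suc mult.commute)
    also have "qmult a b (if even n then (1, 0, 0, 0) else V) V
        = (if even (Suc n) then (1, 0, 0, 0) else V)"
      using assms one by simp
    finally show ?case .
  qed
  have "(\<lambda>n. ((d *\<^sub>R V) [^]\<^bsub>quat_ring UNIV a b\<^esub> n) /\<^sub>R fact n)
      = (\<lambda>n. (if even n then d ^ n /\<^sub>R fact n else 0) *\<^sub>R (1, 0, 0, 0)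
            + (if even n then 0 else d ^ n /\<^sub>R fact n) *\<^sub>R V)"
    unfolding pow by (rule ext) (simp add: mult.commute del: scaleR_Pair)
  then have "(\<lambda>n. ((d *\<^sub>R V) [^]\<^bsub>quat_ring UNIV a b\<^esub> n) /\<^sub>R fact n)
      sums (cosh d *\<^sub>R (1, 0, 0, 0) + sinh d *\<^sub>R V)"
    by (simp only: sums_add[OF bounded_linear.sums[OF bounded_linear_scaleR_left cosh_converges]
        bounded_linear.sums[OF bounded_linear_scaleR_left sinh_converges]])
  then show ?thesis
    using qexp_sums by (rule sums_unique2[symmetric])
qed

text \<open>A hyperbolic \<open>g\<close> with real part above 1 lies on a one-parameter subgroup
  spanned by its own imaginary part. The arc from 1 to \<open>g\<close> therefore stays in the plane
  of 1 and \<open>g\<close>, with positive coefficients in its interior.\<close>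

lemma blocking_point_on_segment:
  assumes block: "blocking_set a b \<Gamma> \<Gamma> (g <#\<^bsub>SL1 UNIV a b\<^esub> \<Gamma>) B"
    and sub: "subgroup \<Gamma> (SL1 UNIV a b)"
    and g: "g \<in> carrier (SL1 UNIV a b)" "fst g > 1"
  obtains \<alpha> \<beta> M where "\<alpha> > 0" "\<beta> > 0" "M \<in> B" "\<alpha> *\<^sub>R (1, 0, 0, 0) + \<beta> *\<^sub>R g \<in> M"
proof -
  obtain x y z w where g_eq: "g = (x, y, z, w)"
    by (cases g)
  have x: "x > 1"
    using g(2) by (simp add: g_eq)
  have nred: "x\<^sup>2 - a * y\<^sup>2 - b * z\<^sup>2 + a * b * w\<^sup>2 = 1"
    using g(1) by (simp add: g_eq carrier_SL1)
  define S where "S = sqrt (x\<^sup>2 - 1)"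
  have S: "S > 0" "S\<^sup>2 = x\<^sup>2 - 1"
    using x by (auto simp: S_def)
  define d where "d = arcosh x"
  have d: "d > 0" "cosh d = x" "sinh d = S"
    using x by (auto simp: d_def S_def sinh_arcosh_real)
  \<comment> \<open>The imaginary part of \<open>g\<close>, normalised to square 1: its own square
    is x^2 - 1 because \<open>g\<close> has reduced norm 1.\<close>
  define V :: quat where "V = (0, y / S, z / S, w / S)"
  have "a * y * y + b * z * z - a * b * w * w = S\<^sup>2"
    using S(2) nred by (simp add: power2_eq_square)
  then have "(a * y * y + b * z * z - a * b * w * w) / S\<^sup>2 = 1"
    using S(1) by simp
  then have VV: "qmult a b V V = (1, 0, 0, 0)"
    by (simp add: V_def power2_eq_square add_divide_distrib diff_divide_distrib)
  define e where "e t = cosh (t * d) *\<^sub>R (1, 0, 0, 0) + sinh (t * d) *\<^sub>R V" for t :: real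
  have e: "qexp a b (t *\<^sub>R (d *\<^sub>R V)) = e t" for t
    using qexp_involution[OF VV, of "t * d"] by (simp only: scaleR_scaleR e_def)
  have e0: "e 0 = (1, 0, 0, 0)" and e1: "e 1 = g"
    using S(1) by (simp_all add: e_def d V_def g_eq)
  define c where "c t = e t <#\<^bsub>SL1 UNIV a b\<^esub> \<Gamma>" for t
  have "(1, 0, 0, 0) <#\<^bsub>SL1 UNIV a b\<^esub> \<Gamma> = \<Gamma>"
    unfolding l_coset_SL1 by force
  then have c0: "c 0 = \<Gamma>" and c1: "c 1 = g <#\<^bsub>SL1 UNIV a b\<^esub> \<Gamma>"
    by (simp_all add: c_def e0 e1)
  have \<Gamma>: "\<Gamma> \<in> lcosets\<^bsub>SL1 UNIV a b\<^esub> \<Gamma>"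
  proof -
    have "(1, 0, 0, 0) \<in> carrier (SL1 UNIV a b)"
      by (simp add: carrier_SL1)
    then show ?thesis
      using c0 by (auto simp: LCOSETS_def c_def e0)
  qed
  have "d *\<^sub>R V \<in> lie_algebra a b"
    by (simp add: lie_algebra_eq V_def)
  moreover have "\<forall>t\<in>{0..1}. c t = qexp a b (t *\<^sub>R (d *\<^sub>R V)) <#\<^bsub>SL1 UNIV a b\<^esub> \<Gamma>"
    unfolding c_def e by blast
  ultimately have "connecting_curve a b \<Gamma> \<Gamma> (g <#\<^bsub>SL1 UNIV a b\<^esub> \<Gamma>) c"
    unfolding connecting_curve_def using \<Gamma> c0 c1 by blast
  then have "c ` {0..1} \<inter> B \<noteq> {}" "\<Gamma> \<notin> B" "g <#\<^bsub>SL1 UNIV a b\<^esub> \<Gamma> \<notin> B"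
    using block by (auto simp: blocking_set_def)
  \<comment> \<open>A blocking set omits both end points of the curve, which forces 0 < t <
    1.\<close>
  then obtain t where t: "0 \<le> t" "t \<le> 1" "c t \<in> B" "t \<noteq> 0" "t \<noteq> 1"
    using c0 c1 by force
  \<comment> \<open>The solution of \<open>e t = \<alpha> + \<beta> g\<close>: imaginary parts
    determine \<beta>, then real parts determine \<alpha>. Positivity of \<alpha> comes from the
    subtraction formula for sinh.\<close>
  define \<beta> where "\<beta> = sinh (t * d) / S"
  define \<alpha> where "\<alpha> = cosh (t * d) - \<beta> * x"
  have "\<beta> > 0"
    using S t d by (simp add: \<beta>_def)
  moreover have "\<alpha> = sinh (d - t * d) / S"
    using S by (simp add: \<alpha>_def \<beta>_def sinh_diff d field_simps)
  then have "\<alpha> > 0"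
    using S t d by simp
  moreover have "\<alpha> *\<^sub>R (1, 0, 0, 0) + \<beta> *\<^sub>R g = e t"
    by (simp add: e_def \<alpha>_def \<beta>_def g_eq V_def)
  moreover have "e t \<in> c t"
  proof -
    have "(1, 0, 0, 0) \<in> \<Gamma>"
      using subgroup.one_closed[OF sub] by (simp add: SL1_def)
    moreover have "qmult a b (e t) (1, 0, 0, 0) = e t"
      by (cases "e t") simp
    ultimately show ?thesis
      unfolding c_def l_coset_SL1 by (metis image_eqI)
  qed
  ultimately show thesis
    using that t(3) by metis
qed

section \<open>Rational points of the torus\<close>

lemma rational_combination_zero:
  fixes \<theta> :: real
  assumes "\<theta> \<notin> \<rat>" "p \<in> \<rat>" "q \<in> \<rat>" "\<theta> * p = q"
  shows "p = 0" "q = 0"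
proof -
  show "p = 0"
  proof (rule ccontr)
    assume "p \<noteq> 0"
    then have "\<theta> = q / p"
      using assms(4) by (simp add: field_simps)
    then show False
      using assms(1-3) by simp
  qed
  then show "q = 0"
    using assms(4) by simp
qed

text \<open>\<open>torus_quat X Y r s\<close> is the product of \<open>X + Yi\<close> and \<open>r + sj\<close>.\<close>

definition torus_quat :: "real \<Rightarrow> real \<Rightarrow> real \<Rightarrow> real \<Rightarrow> quat" where
  "torus_quat X Y r s = (X * r, Y * r, X * s, Y * s)"

text \<open>The polarised form N(\<alpha> + \<beta> T) = \<alpha>^2 + \<alpha> \<beta> tr(T) +
  \<beta>^2 N(T), with tr(T) = 2 X r and N(T) = 1.\<close>

lemma nred_segment_torus_quat:
  fixes X Y r s :: real
  assumes "X\<^sup>2 - a * Y\<^sup>2 = 1" "r\<^sup>2 - b * s\<^sup>2 = 1"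
  shows "nred a b (\<alpha> *\<^sub>R (1, 0, 0, 0) + \<beta> *\<^sub>R torus_quat X Y r s)
    = \<alpha>\<^sup>2 + \<beta>\<^sup>2 + 2 * \<alpha> * \<beta> * X * r"
proof -
  have "nred a b (\<alpha> *\<^sub>R (1, 0, 0, 0) + \<beta> *\<^sub>R torus_quat X Y r s)
    = \<alpha>\<^sup>2 + 2 * \<alpha> * \<beta> * X * r + \<beta>\<^sup>2 * ((X\<^sup>2 - a * Y\<^sup>2) * (r\<^sup>2 - b * s\<^sup>2))"
    by (simp add: torus_quat_def power2_eq_square algebra_simps)
  then show ?thesis
    by (simp add: assms)
qed

text \<open>If \<open>\<theta> = \<alpha> / \<beta>\<close> is irrational, comparing the coefficients of \<open>1\<close> and \<open>\<theta>\<close> shows that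
  \<open>\<epsilon>\<close> and \<open>T \<epsilon>\<close> have imaginary parts proportional to that of \<open>T'\<close>; hence so has \<open>T\<close>.\<close>

lemma blocking_ratio_rational:
  fixes X Y X' Y' r s \<alpha> \<beta> :: real
  assumes rat: "X \<in> \<rat>" "Y \<in> \<rat>" "X' \<in> \<rat>" "Y' \<in> \<rat>" "r \<in> \<rat>" "s \<in> \<rat>"
    and X: "X > 0" "X\<^sup>2 - a * Y\<^sup>2 = 1" and X': "X' > 0" "X'\<^sup>2 - a * Y'\<^sup>2 = 1" "X \<noteq> X'"
    and r: "r > 0" "s > 0" and \<beta>: "\<beta> > 0"
    and \<epsilon>: "\<epsilon> \<in> carrier (SL1 \<rat> a b)"
    and eq: "\<alpha>' *\<^sub>R (1, 0, 0, 0) + \<beta>' *\<^sub>R torus_quat X' Y' r s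
      = qmult a b (\<alpha> *\<^sub>R (1, 0, 0, 0) + \<beta> *\<^sub>R torus_quat X Y r s) \<epsilon>"
  shows "\<alpha> / \<beta> \<in> \<rat>"
proof (rule ccontr)
  assume irr: "\<alpha> / \<beta> \<notin> \<rat>"
  define \<theta> where "\<theta> = \<alpha> / \<beta>"
  define \<nu> where "\<nu> = \<beta>' / \<beta>"
  obtain e0 e1 e2 e3 where e: "\<epsilon> = (e0, e1, e2, e3)"
    by (cases \<epsilon>)
  have e_rat: "e0 \<in> \<rat>" "e1 \<in> \<rat>" "e2 \<in> \<rat>" "e3 \<in> \<rat>"
    using \<epsilon> by (auto simp: e carrier_SL1)
  define T where "T = torus_quat X Y r s"
  obtain h0 h1 h2 h3 where h: "qmult a b T \<epsilon> = (h0, h1, h2, h3)"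
    by (cases "qmult a b T \<epsilon>")
  have h_rat: "h0 \<in> \<rat>" "h1 \<in> \<rat>" "h2 \<in> \<rat>" "h3 \<in> \<rat>"
    using h rat e_rat by (auto simp: T_def torus_quat_def e)
  have one: "qmult a b (1, 0, 0, 0) \<epsilon> = \<epsilon>"
    by (simp add: e)
  have "\<alpha>' *\<^sub>R (1, 0, 0, 0) + \<beta>' *\<^sub>R torus_quat X' Y' r s = \<alpha> *\<^sub>R \<epsilon> + \<beta> *\<^sub>R qmult a b T \<epsilon>"
    unfolding eq by (simp only: bounded_bilinear.add_left[OF bounded_bilinear_qmult]
        bounded_bilinear.scaleR_left[OF bounded_bilinear_qmult] one flip: T_def)
  then have "\<beta>' * (Y' * r) = \<alpha> * e1 + \<beta> * h1" "\<beta>' * (X' * s) = \<alpha> * e2 + \<beta> * h2"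
    "\<beta>' * (Y' * s) = \<alpha> * e3 + \<beta> * h3"
    unfolding h by (simp_all add: e torus_quat_def)
  then have v: "\<nu> * (Y' * r) = \<theta> * e1 + h1" "\<nu> * (X' * s) = \<theta> * e2 + h2"
    "\<nu> * (Y' * s) = \<theta> * e3 + h3"
    using \<beta> by (simp_all add: \<nu>_def \<theta>_def field_simps)
  \<comment> \<open>The proportionality factors of the imaginary parts of \<epsilon> and T
    \<epsilon> to that of T'. They are read off at the j-coordinate because \<open>X' * s\<close> is
    nonzero, whereas Y' may vanish.\<close>
  define q p where "q = e2 / (X' * s)" and "p = h2 / (X' * s)"
  have Xs: "X' * s \<noteq> 0"
    using X' r by simp
  have "(\<theta> * e1 + h1) * (X' * s) = (\<theta> * e2 + h2) * (Y' * r)"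
    by (simp flip: v)
  then have "\<theta> * (e1 * (X' * s) - e2 * (Y' * r)) = h2 * (Y' * r) - h1 * (X' * s)"
    by (simp add: algebra_simps)
  from rational_combination_zero[OF irr[folded \<theta>_def] _ _ this]
  have "e1 * (X' * s) = e2 * (Y' * r)" "h1 * (X' * s) = h2 * (Y' * r)"
    using rat e_rat h_rat by simp_all
  then have 1: "e1 = q * (Y' * r)" "h1 = p * (Y' * r)"
    using Xs by (simp_all only: q_def p_def times_divide_eq_left eq_divide_eq if_False if_True simp_thms)
  have "(\<theta> * e3 + h3) * (X' * s) = (\<theta> * e2 + h2) * (Y' * s)"
    by (simp flip: v)
  then have "\<theta> * (e3 * (X' * s) - e2 * (Y' * s)) = h2 * (Y' * s) - h3 * (X' * s)"
    by (simp add: algebra_simps)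
  from rational_combination_zero[OF irr[folded \<theta>_def] _ _ this]
  have "e3 * (X' * s) = e2 * (Y' * s)" "h3 * (X' * s) = h2 * (Y' * s)"
    using rat e_rat h_rat by (metis Rats_diff Rats_mult eq_iff_diff_eq_0)+
  then have 3: "e3 = q * (Y' * s)" "h3 = p * (Y' * s)"
    using Xs by (simp_all only: q_def p_def times_divide_eq_left eq_divide_eq if_False if_True simp_thms)
  have 2: "e2 = q * (X' * s)" "h2 = p * (X' * s)"
    using Xs by (simp_all add: q_def p_def)
  have "T = qmult a b (qmult a b T \<epsilon>) (qconj \<epsilon>)"
    using nred_SL1[OF \<epsilon>] by (simp add: qmult_assoc qmult_qconj_right) (cases T, simp)
  also have "\<dots> = qmult a b (h0, h1, h2, h3) (e0, - e1, - e2, - e3)"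
    by (simp add: h) (simp add: e qconj_def)
  finally have T: "torus_quat X Y r s = qmult a b (h0, h1, h2, h3) (e0, - e1, - e2, - e3)"
    by (simp add: T_def)
  \<comment> \<open>With v the imaginary part of T', T = (h0 + p v)(e0 - q v). As v^2 is real, the
    imaginary part of this product is \<mu> v.\<close>
  define \<mu> where "\<mu> = p * e0 - q * h0"
  have "Y * r = \<mu> * Y' * r" "X * s = \<mu> * X' * s"
    using T by (simp_all add: torus_quat_def \<mu>_def 1 2 3 algebra_simps)
  then have Y: "Y = \<mu> * Y'" and Xmu: "X = \<mu> * X'"
    using r by simp_all
  \<comment> \<open>Proportional points of the same hyperbola with positive first coordinates
    coincide, contrary to X and X' being different.\<close>
  have "X\<^sup>2 - a * Y\<^sup>2 = \<mu>\<^sup>2 * (X'\<^sup>2 - a * Y'\<^sup>2)"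
    by (simp add: Y Xmu algebra_simps)
  then have "\<mu>\<^sup>2 = 1"
    using X X' by simp
  moreover have "\<mu> > 0"
    using X(1) X'(1) by (simp add: Xmu zero_less_mult_iff)
  ultimately have "\<mu> = 1"
    by (simp add: power2_eq_1_iff)
  then show False
    using X'(3) Xmu by simp
qed

section \<open>Integrality, denominators and lower bounds for the reduced norm\<close>

lemma Ints_pos_ge_1:
  fixes x :: real
  assumes "x \<in> \<int>" "x > 0"
  shows "x \<ge> 1"
  using assms by (auto elim!: Ints_cases)

text \<open>Integrality forces \<alpha> and \<beta> to be at least constants depending only on s and
  D, so the cross term of the reduced norm grows at least linearly in X.\<close>

lemma integral_segment_nred_ge:
  fixes D X Y r s \<alpha> \<beta> :: real
  assumes D: "D > 0" "D \<in> \<int>" "D * X \<in> \<int>" "D * Y \<in> \<int>"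
    and X: "X > 0" "X\<^sup>2 - a * Y\<^sup>2 = 1"
    and r: "r \<in> \<int>" "s \<in> \<int>" "r > 0" "s > 0" "r\<^sup>2 - b * s\<^sup>2 = 1"
    and pos: "\<alpha> > 0" "\<beta> > 0"
    and int: "\<alpha> *\<^sub>R (1, 0, 0, 0) + \<beta> *\<^sub>R torus_quat X Y r s \<in> \<int> \<times> \<int> \<times> \<int> \<times> \<int>"
  shows "X \<le> s\<^sup>2 * D ^ 3 * nred a b (\<alpha> *\<^sub>R (1, 0, 0, 0) + \<beta> *\<^sub>R torus_quat X Y r s)"
proof -
  have i: "\<alpha> + \<beta> * (X * r) \<in> \<int>" "\<beta> * (X * s) \<in> \<int>" "\<beta> * (Y * s) \<in> \<int>"
    using int by (simp_all add: torus_quat_def)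
  \<comment> \<open>The norm equation acts as a Bezout relation between X and Y and isolates \<beta>
    from the j- and k-coordinates; the real coordinate then isolates \<alpha>.\<close>
  have "(\<beta> * (X * s)) * (D * X) - a * ((\<beta> * (Y * s)) * (D * Y)) = \<beta> * s * D * (X\<^sup>2 - a * Y\<^sup>2)"
    by (simp add: algebra_simps power2_eq_square)
  then have "\<beta> * s * D = (\<beta> * (X * s)) * (D * X) - a * ((\<beta> * (Y * s)) * (D * Y))"
    by (simp add: X)
  then have \<beta>_int: "\<beta> * s * D \<in> \<int>"
    using i D by simp
  have "\<alpha> * s * D\<^sup>2 = s * D\<^sup>2 * (\<alpha> + \<beta> * (X * r)) - (\<beta> * s * D) * r * (D * X)"
    by (simp add: algebra_simps power2_eq_square)
  then have \<alpha>_int: "\<alpha> * s * D\<^sup>2 \<in> \<int>"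
    using i D r \<beta>_int by simp
  have "\<alpha> * s * D\<^sup>2 \<ge> 1" "\<beta> * s * D \<ge> 1" "r \<ge> 1"
    using \<alpha>_int \<beta>_int r pos D by (auto intro!: Ints_pos_ge_1)
  then have "1 * 1 * 1 \<le> (\<alpha> * s * D\<^sup>2) * (\<beta> * s * D) * r"
    by (intro mult_mono) auto
  then have "X * 1 \<le> X * ((\<alpha> * s * D\<^sup>2) * (\<beta> * s * D) * r)"
    using X by (intro mult_left_mono) auto
  also have "\<dots> = s\<^sup>2 * D ^ 3 * (\<alpha> * \<beta> * X * r)"
    by (simp add: power2_eq_square power3_eq_cube)
  also have "\<dots> \<le> s\<^sup>2 * D ^ 3 * nred a b (\<alpha> *\<^sub>R (1, 0, 0, 0) + \<beta> *\<^sub>R torus_quat X Y r s)"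
    unfolding nred_segment_torus_quat[OF X(2) r(5)] using D X r pos
    by (intro mult_left_mono) (auto simp: mult_pos_pos add_nonneg_pos less_imp_le)
  finally show ?thesis
    by simp
qed

lemma Rats_common_denominator:
  fixes x y :: real
  assumes "x \<in> \<rat>" "y \<in> \<rat>"
  obtains D where "D > 0" "D \<in> \<int>" "D * x \<in> \<int>" "D * y \<in> \<int>"
proof -
  obtain h k :: int where x: "x = h / k" "k > 0"
    using assms(1) by (meson Rats_cases')
  obtain h' k' :: int where y: "y = h' / k'" "k' > 0"
    using assms(2) by (meson Rats_cases')
  have "of_int (k * k') * x = (of_int (h * k') :: real)" "of_int (k * k') * y = (of_int (h' * k) :: real)"
    using x y by simp_all
  then show thesis
    using x y by (intro that[of "of_int (k * k')"]) (metis Ints_of_int of_int_0_less_iff mult_pos_pos)+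
qed

text \<open>Right multiplication of x + yi by the integral units P + Qi and r + sj stays in the
  coset; the first factor makes X large, and D still clears the denominators of X and Y.\<close>

lemma torus_quat_in_coset:
  fixes x y D r s :: real
  assumes nonsq: "\<And>m::nat. a \<noteq> m\<^sup>2" and xy: "x\<^sup>2 - a * y\<^sup>2 = 1"
    and D: "D * x \<in> \<int>" "D * y \<in> \<int>"
    and rs: "r \<in> \<int>" "s \<in> \<int>" "r\<^sup>2 - b * s\<^sup>2 = 1"
  obtains X Y where "X > real n" "X\<^sup>2 - a * Y\<^sup>2 = 1" "D * X \<in> \<int>" "D * Y \<in> \<int>"
    "torus_quat X Y r s \<in> (x, y, 0, 0) <#\<^bsub>SL1 UNIV a b\<^esub> carrier (SL1 \<int> a b)"
proof -
  obtain p q :: int where pq: "p\<^sup>2 - int a * q\<^sup>2 = 1" "p > int n" "q > 0"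
    by (rule pell_large[OF nonsq])
  \<comment> \<open>The signs are those of x and y, so that the two summands of \<open>X\<close>
    cannot cancel; as x^2 = 1 + a y^2 gives \<open>\<bar>x\<bar> \<ge> 1\<close>, it follows that
    \<open>X \<ge> p\<close>.\<close>
  define P Q :: real where "P = (if x \<ge> 0 then of_int p else - of_int p)"
    and "Q = (if y \<ge> 0 then of_int q else - of_int q)"
  have "P\<^sup>2 - a * Q\<^sup>2 = of_int (p\<^sup>2 - int a * q\<^sup>2)"
    by (simp add: P_def Q_def)
  then have PQ: "P\<^sup>2 - a * Q\<^sup>2 = 1" "P \<in> \<int>" "Q \<in> \<int>"
    using pq by (auto simp: P_def Q_def)
  define X Y where "X = x * P + a * y * Q" and "Y = x * Q + y * P"
  have "x\<^sup>2 \<ge> 1\<^sup>2"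
    using xy by (smt (verit) mult_nonneg_nonneg of_nat_0_le_iff one_power2 zero_le_power2)
  then have "\<bar>x\<bar> \<ge> 1"
    using abs_le_square_iff[of 1 x] by simp
  then have "1 * of_int p \<le> \<bar>x\<bar> * of_int p"
    using pq by (intro mult_right_mono) auto
  moreover have "x * P = \<bar>x\<bar> * of_int p" "y * Q \<ge> 0"
    using pq by (auto simp: P_def Q_def mult_nonpos_nonneg)
  moreover have "a * (y * Q) \<ge> 0"
    using calculation by simp
  moreover have "real_of_int p > n"
    using pq(2) by linarith
  ultimately have "X > real n"
    unfolding X_def mult.assoc by linarith
  moreover have "X\<^sup>2 - a * Y\<^sup>2 = (x\<^sup>2 - a * y\<^sup>2) * (P\<^sup>2 - a * Q\<^sup>2)"
    by (simp add: X_def Y_def power2_eq_square algebra_simps)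
  then have "X\<^sup>2 - a * Y\<^sup>2 = 1"
    by (simp add: PQ xy)
  moreover have "D * X = (D * x) * P + a * (D * y) * Q" "D * Y = (D * x) * Q + (D * y) * P"
    by (simp_all add: X_def Y_def algebra_simps)
  then have "D * X \<in> \<int>" "D * Y \<in> \<int>"
    using D PQ by simp_all
  moreover have "torus_quat X Y r s = qmult a b (x, y, 0, 0) (torus_quat P Q r s)"
    by (simp add: torus_quat_def X_def Y_def algebra_simps)
  moreover have "(P * r)\<^sup>2 - a * (Q * r)\<^sup>2 - b * (P * s)\<^sup>2 + a * b * (Q * s)\<^sup>2
      = (P\<^sup>2 - a * Q\<^sup>2) * (r\<^sup>2 - b * s\<^sup>2)"
    by (simp add: power2_eq_square algebra_simps)
  then have "torus_quat P Q r s \<in> carrier (SL1 \<int> a b)"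
    using PQ rs by (simp add: torus_quat_def carrier_SL1)
  ultimately show thesis
    using that unfolding l_coset_SL1 by blast
qed

lemma quat_common_denominator:
  fixes g :: quat
  assumes "g \<in> \<rat> \<times> \<rat> \<times> \<rat> \<times> \<rat>"
  obtains E where "E > 0" "E *\<^sub>R g \<in> \<int> \<times> \<int> \<times> \<int> \<times> \<int>"
proof -
  obtain x y z w where g: "g = (x, y, z, w)"
    by (cases g)
  obtain D where D: "D > 0" "D \<in> \<int>" "D * x \<in> \<int>" "D * y \<in> \<int>"
    using assms by (auto simp: g elim: Rats_common_denominator)
  obtain D' where D': "D' > 0" "D' \<in> \<int>" "D' * z \<in> \<int>" "D' * w \<in> \<int>"
    using assms by (auto simp: g elim: Rats_common_denominator)
  have "D * D' * x = D' * (D * x)" "D * D' * y = D' * (D * y)"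
    "D * D' * z = D * (D' * z)" "D * D' * w = D * (D' * w)"
    by simp_all
  then have "D * D' * x \<in> \<int>" "D * D' * y \<in> \<int>" "D * D' * z \<in> \<int>" "D * D' * w \<in> \<int>"
    using D D' by (simp_all only: Ints_mult)
  then show thesis
    using D D' by (intro that[of "D * D'"]) (auto simp: g)
qed

lemma nred_scaleR: "nred a b (c *\<^sub>R g) = c\<^sup>2 * nred a b g"
  by (cases g) (simp add: power_mult_distrib algebra_simps)

section \<open>Contradiction from a finite blocking set\<close>

lemma not_blockable_rational_torus:
  assumes nonsq: "\<And>m::nat. a \<noteq> m\<^sup>2" "\<And>m::nat. b \<noteq> m\<^sup>2"
    and xy: "(x, y, 0, 0) \<in> carrier (SL1 \<rat> a b)"
    and \<Gamma>: "\<Gamma> = carrier (SL1 \<int> a b)"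
  shows "\<not> blockable a b \<Gamma> \<Gamma> ((x, y, 0, 0) <#\<^bsub>SL1 UNIV a b\<^esub> \<Gamma>)"
proof
  interpret G: group "SL1 UNIV a b"
    by (rule group_SL1) simp
  have sub: "subgroup \<Gamma> (SL1 UNIV a b)"
    unfolding \<Gamma> by (rule subgroup_SL1) simp
  define m where "m = (x, y, 0, 0) <#\<^bsub>SL1 UNIV a b\<^esub> \<Gamma>"
  have xy_carrier: "(x, y, 0, 0) \<in> carrier (SL1 UNIV a b)"
    and xy1: "x\<^sup>2 - a * y\<^sup>2 = 1" "x \<in> \<rat>" "y \<in> \<rat>"
    using xy by (simp_all add: carrier_SL1)
  obtain D where D: "D > 0" "D \<in> \<int>" "D * x \<in> \<int>" "D * y \<in> \<int>"
    using Rats_common_denominator[OF xy1(2,3)] by blast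
  obtain r' s' :: int where "r'\<^sup>2 - int b * s'\<^sup>2 = 1" "r' > int 1" "s' > 0"
    by (rule pell_large[OF nonsq(2)])
  moreover define r s :: real where "r = of_int r'" and "s = of_int s'"
  moreover have "r\<^sup>2 - b * s\<^sup>2 = of_int (r'\<^sup>2 - int b * s'\<^sup>2)"
    by (simp add: r_def s_def)
  ultimately have rs: "r\<^sup>2 - b * s\<^sup>2 = 1" "r > 1" "s > 0" "r \<in> \<int>" "s \<in> \<int>"
    by simp_all
  have "\<forall>n. \<exists>X Y :: real. X > real n \<and> X\<^sup>2 - a * Y\<^sup>2 = 1 \<and> D * X \<in> \<int> \<and> D * Y \<in> \<int> \<and> torus_quat X Y r s \<in> m"
    unfolding m_def \<Gamma> using torus_quat_in_coset[OF nonsq(1) xy1(1) D(3,4) rs(4,5,1)] by metis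
  then obtain X Y :: "nat \<Rightarrow> real" where XY: "\<And>n. X n > real n" "\<And>n. (X n)\<^sup>2 - a * (Y n)\<^sup>2 = 1"
      "\<And>n. D * X n \<in> \<int>" "\<And>n. D * Y n \<in> \<int>" "\<And>n. torus_quat (X n) (Y n) r s \<in> m"
    by metis
  have rat: "X n \<in> \<rat>" "Y n \<in> \<rat>" for n
  proof -
    have "X n = (D * X n) / D" "Y n = (D * Y n) / D"
      using D(1) by simp_all
    then show "X n \<in> \<rat>" "Y n \<in> \<rat>"
      using XY(3,4)[of n] D(2) Ints_subset_Rats by (metis Rats_divide subsetD)+
  qed
  define T where "T n = torus_quat (X n) (Y n) r s" for n
  assume "blockable a b \<Gamma> \<Gamma> ((x, y, 0, 0) <#\<^bsub>SL1 UNIV a b\<^esub> \<Gamma>)"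
  then obtain B where B: "blocking_set a b \<Gamma> \<Gamma> m B"
    by (auto simp: blockable_def m_def)
  then have B_finite: "finite B" and B_cosets: "B \<subseteq> lcosets\<^bsub>SL1 UNIV a b\<^esub> \<Gamma>"
    by (auto simp: blocking_set_def)
  define hits where "hits n M \<longleftrightarrow> (\<exists>\<alpha> \<beta>. \<alpha> > 0 \<and> \<beta> > 0 \<and> \<alpha> *\<^sub>R (1, 0, 0, 0) + \<beta> *\<^sub>R T n \<in> M)"
    for n M
  \<comment> \<open>From n = 1 on, X n > 1; together with r > 1 this puts the real part of
    \<open>T n\<close> above 1.\<close>
  have "\<exists>M\<in>B. hits n M" if "n \<in> {1..}" for n
  proof -
    have T: "T n \<in> (x, y, 0, 0) <#\<^bsub>SL1 UNIV a b\<^esub> \<Gamma>"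
      using XY(5)[of n] by (simp add: T_def m_def)
    then have "T n \<in> carrier (SL1 UNIV a b)"
      using subgroup.elemlcos_carrier[OF sub G.group_axioms xy_carrier] by blast
    moreover have "m = T n <#\<^bsub>SL1 UNIV a b\<^esub> \<Gamma>"
      unfolding m_def by (rule G.l_repr_independence[OF T xy_carrier sub])
    moreover have "1 * 1 < X n * r"
      using XY(1)[of n] that rs by (intro mult_strict_mono) auto
    then have "fst (T n) > 1"
      by (simp add: T_def torus_quat_def)
    ultimately show ?thesis
      using blocking_point_on_segment[OF _ sub, where g = "T n"] B unfolding hits_def by metis
  qed
  then have "\<exists>M\<in>B. infinite {n \<in> {1..}. hits n M}"
    using B_finite by (intro pigeonhole_infinite_rel) (auto simp: infinite_Ici)
  then obtain M where M: "M \<in> B" and inf: "infinite {n \<in> {1..}. hits n M}"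
    by blast
  define S where "S = {n \<in> {1..}. hits n M}"
  have S_large: "\<exists>n\<in>S. real n > c" for c
  proof -
    obtain k :: nat where "c < k"
      using reals_Archimedean2 by blast
    moreover obtain n where "n \<in> S" "n > k"
      using inf unfolding S_def[symmetric] infinite_nat_iff_unbounded by blast
    ultimately show ?thesis
      by (intro bexI[of _ n]) auto
  qed
  have S_pos: "X n > 0" if "n \<in> S" for n
    using XY(1)[of n] by (smt (verit) of_nat_0_le_iff)
  obtain h where h: "h \<in> carrier (SL1 UNIV a b)" "M = h <#\<^bsub>SL1 UNIV a b\<^esub> \<Gamma>"
    using M B_cosets by (auto simp: LCOSETS_def)
  have M_mult: "\<exists>\<epsilon>\<in>\<Gamma>. v = qmult a b u \<epsilon>" if "u \<in> M" "v \<in> M" for u v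
  proof -
    have "M = u <#\<^bsub>SL1 UNIV a b\<^esub> \<Gamma>"
      using G.l_repr_independence[OF _ h(1) sub] that(1) unfolding h(2) by blast
    then show ?thesis
      using that(2) by (auto simp: l_coset_SL1)
  qed
  obtain k where k: "k \<in> S"
    using S_large by blast
  then obtain \<alpha> \<beta> where \<alpha>\<beta>: "\<alpha> > 0" "\<beta> > 0" "\<alpha> *\<^sub>R (1, 0, 0, 0) + \<beta> *\<^sub>R T k \<in> M"
    by (auto simp: S_def hits_def)
  define u where "u = \<alpha> *\<^sub>R (1, 0, 0, 0) + \<beta> *\<^sub>R T k"
  have ratio: "\<alpha> / \<beta> \<in> \<rat>"
  proof -
    \<comment> \<open>Since X n > n, this choice makes X n differ from X k, as the comparison of two
      curves requires.\<close>
    obtain n where n: "n \<in> S" "real n > X k"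
      using S_large by blast
    then obtain \<alpha>' \<beta>' where "\<alpha>' *\<^sub>R (1, 0, 0, 0) + \<beta>' *\<^sub>R T n \<in> M"
      by (auto simp: S_def hits_def)
    then obtain \<epsilon> where \<epsilon>: "\<epsilon> \<in> \<Gamma>"
        "\<alpha>' *\<^sub>R (1, 0, 0, 0) + \<beta>' *\<^sub>R T n = qmult a b (\<alpha> *\<^sub>R (1, 0, 0, 0) + \<beta> *\<^sub>R T k) \<epsilon>"
      using M_mult[OF \<alpha>\<beta>(3)] by blast
    have ne: "X k \<noteq> X n"
      using n(2) XY(1)[of n] by linarith
    have \<epsilon>_rat: "\<epsilon> \<in> carrier (SL1 \<rat> a b)"
      using \<epsilon>(1) Ints_subset_Rats unfolding \<Gamma> by (cases \<epsilon>) (auto simp: carrier_SL1)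
    have rs_rat: "r \<in> \<rat>" "s \<in> \<rat>" and r_pos: "r > 0"
      using rs Ints_subset_Rats by auto
    show ?thesis
      by (rule blocking_ratio_rational[OF rat rat rs_rat S_pos[OF k] XY(2) S_pos[OF n(1)] XY(2) ne
            r_pos rs(3) \<alpha>\<beta>(2) \<epsilon>_rat \<epsilon>(2)[unfolded T_def]])
  qed
  \<comment> \<open>This element is \<alpha> / \<beta> + T k, so rationality of the ratio makes all
    its coordinates rational.\<close>
  have "(1 / \<beta>) *\<^sub>R u \<in> \<rat> \<times> \<rat> \<times> \<rat> \<times> \<rat>"
    using ratio \<alpha>\<beta>(2) rat[of k] rs Ints_subset_Rats
    by (auto simp: u_def T_def torus_quat_def add_divide_distrib)
  then obtain E where E: "E > 0" "E *\<^sub>R ((1 / \<beta>) *\<^sub>R u) \<in> \<int> \<times> \<int> \<times> \<int> \<times> \<int>"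
    by (rule quat_common_denominator)
  define K where "K = E / \<beta>"
  have K: "K > 0" "K *\<^sub>R u \<in> \<int> \<times> \<int> \<times> \<int> \<times> \<int>"
    using E \<alpha>\<beta>(2) by (simp_all add: K_def)
  \<comment> \<open>\<open>K\<close> and \<open>u\<close> are already fixed, and every element of
    \<open>M\<close> has the reduced norm of \<open>u\<close>, so n may exceed the resulting bound
    on X n.\<close>
  obtain n where n: "n \<in> S" "real n > s\<^sup>2 * D ^ 3 * (K\<^sup>2 * nred a b u)"
    using S_large by blast
  then obtain \<alpha>' \<beta>' where \<alpha>'\<beta>': "\<alpha>' > 0" "\<beta>' > 0" "\<alpha>' *\<^sub>R (1, 0, 0, 0) + \<beta>' *\<^sub>R T n \<in> M"
    by (auto simp: S_def hits_def)
  define v where "v = \<alpha>' *\<^sub>R (1, 0, 0, 0) + \<beta>' *\<^sub>R T n"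
  obtain \<epsilon> where \<epsilon>: "\<epsilon> \<in> \<Gamma>" "v = qmult a b u \<epsilon>"
    using M_mult[OF \<alpha>\<beta>(3) \<alpha>'\<beta>'(3)] by (auto simp: u_def v_def)
  have Kv: "K *\<^sub>R v = (K * \<alpha>') *\<^sub>R (1, 0, 0, 0) + (K * \<beta>') *\<^sub>R torus_quat (X n) (Y n) r s"
    by (simp add: v_def T_def scaleR_add_right del: scaleR_Pair)
  have "K *\<^sub>R v = qmult a b (K *\<^sub>R u) \<epsilon>"
    unfolding \<epsilon>(2) bounded_bilinear.scaleR_left[OF bounded_bilinear_qmult] ..
  then have "K *\<^sub>R v \<in> \<int> \<times> \<int> \<times> \<int> \<times> \<int>"
    using K(2) \<epsilon>(1) unfolding \<Gamma> by (cases "K *\<^sub>R u"; cases \<epsilon>) (auto simp: carrier_SL1)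
  then have "X n \<le> s\<^sup>2 * D ^ 3 * nred a b (K *\<^sub>R v)"
    unfolding Kv using integral_segment_nred_ge[OF D(1,2) XY(3,4) S_pos[OF n(1)] XY(2) rs(4,5) _ rs(3,1)]
      rs(2) K(1) \<alpha>'\<beta>' by simp
  also have "nred a b (K *\<^sub>R v) = K\<^sup>2 * nred a b u"
    using \<epsilon> by (simp add: nred_scaleR nred_qmult nred_SL1 \<Gamma>)
  finally show False
    using n(2) XY(1)[of n] by linarith
qed

theorem theorem3:
  fixes a b :: nat and \<Gamma> :: "quat set"
  defines "\<Gamma> \<equiv> carrier (SL1 \<int> a b)"
  assumes "a > 0" and "b > 0"
    and "cocompact_lattice \<Gamma> (SL1 UNIV a b)"
  shows "(\<forall>x y. (x, y, 0, 0) \<in> carrier (SL1 \<rat> a b) \<longrightarrow>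
            \<not> blockable a b \<Gamma> \<Gamma> ((x, y, 0, 0) <#\<^bsub>SL1 UNIV a b\<^esub> \<Gamma>)) \<and>
         \<not> blockable_space a b \<Gamma>"
proof -
  have \<Gamma>: "\<Gamma> = carrier (SL1 \<int> a b)"
    by (simp add: \<Gamma>_def)
  note nonsq = cocompact_nonsquare[OF \<Gamma> assms(4,2,3)]
  have not_blockable: "\<not> blockable a b \<Gamma> \<Gamma> ((x, y, 0, 0) <#\<^bsub>SL1 UNIV a b\<^esub> \<Gamma>)"
    if "(x, y, 0, 0) \<in> carrier (SL1 \<rat> a b)" for x y
    by (rule not_blockable_rational_torus[OF nonsq that \<Gamma>])
  moreover have "\<not> blockable_space a b \<Gamma>"
  proof
    assume space: "blockable_space a b \<Gamma>"
    \<comment> \<open>The case x = 1, y = 0 shows that the base point is not blockable from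
      itself.\<close>
    have one: "(1, 0, 0, 0) \<in> carrier (SL1 R a b)" if "0 \<in> R" "1 \<in> R" for R
      using that by (simp add: carrier_SL1)
    have coset: "(1, 0, 0, 0) <#\<^bsub>SL1 UNIV a b\<^esub> \<Gamma> = \<Gamma>"
      unfolding l_coset_SL1 by force
    then have "\<Gamma> \<in> lcosets\<^bsub>SL1 UNIV a b\<^esub> \<Gamma>"
      using one[of UNIV] by (auto simp: LCOSETS_def)
    then have "blockable a b \<Gamma> \<Gamma> \<Gamma>"
      using space by (simp add: blockable_space_def)
    then show False
      using not_blockable[OF one] coset by simp
  qed
  ultimately show ?thesis
    by blast
qed

end
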